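(* Let $f:\mathbb{F}_2^n\to\mathbb{F}_2^n$ be a Boolean monomial system whose dependency graph $\mathcal{X}$ is strongly connected with loop number $t\ge 1$ and $n$ vertices $a_1,\dots,a_n$ (not counting $\varepsilon$). Suppose the vertices are enumerated in the form $$(a_1,\ldots,a_{i_1}),(a_{i_1+1},\ldots,a_{i_2}),\ldots,(a_{i_{t-1}+1},\ldots,a_{i_t}),\qquad i_t=n,$$ where each group is a loop equivalence class and there is an edge $a_{i_j}\to a_{i_j+1}$ for all $j=1,\ldots,t-1$. Set $i_0:=0$ and let $s_j:=i_j-i_{j-1}$ be the size of the $j$-th group. Put $y_1=x_1\cdots x_{i_1}$, $y_2=x_{i_1+1}\cdots x_{i_2}$, $\ldots$, $y_t=x_{i_{t-1}+1}\cdots x_{i_t}$. Then there is an $m\in\mathbb{N}$ such that $$f^{mt}=(\underbrace{y_1,\ldots,y_1}_{s_1\text{ times}},\underbrace{y_2,\ldots,y_2}_{s_2\text{ times}},\ldots,\underbrace{y_t,\ldots,y_t}_{s_t\text{ times}}),$$ $$f^{mt+1}=(\underbrace{y_2,\ldots,y_2}_{s_1\text{ times}},\underbrace{y_3,\ldots,y_3}_{s_2\text{ times}},\ldots,\underbrace{y_1,\ldots,y_1}_{s_t\text{ times}}),$$ and in general, for all $j\ge 0$, with subscripts of $y$ read modulo $t$ in $\{1,\dots,t\}$, $$f^{mt+j}=(\underbrace{y_{j+1},\ldots,y_{j+1}}_{s_1\text{ times}},\underbrace{y_{j+2},\ldots,y_{j+2}}_{s_2\text{ times}},\ldots,\underbrace{y_{j},\ldots,y_{j}}_{s_t\text{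 times}}).$$
   Context: A Boolean monomial system is a map $f=(f_1,\ldots,f_n):\mathbb{F}_2^n\to\mathbb{F}_2^n$ where each coordinate function is $f_i=\alpha_i x_1^{\varepsilon_{1i}}\cdots x_n^{\varepsilon_{ni}}$ with $\alpha_i,\varepsilon_{ji}\in\{0,1\}$ (and all $\varepsilon_{ji}=0$ if $\alpha_i=0$); so each $f_i$ is $0$, $1$, or a product of distinct variables. $f^m$ denotes the $m$-fold composition of $f$ with itself. The dependency graph $\mathcal{X}$ of $f$ is the digraph with vertex set $\{a_1,\ldots,a_n,\varepsilon\}$, with an edge $a_i\to a_j$ iff $\alpha_i=1$ and $\varepsilon_{ji}=1$ (i.e. $x_j$ is a factor of $f_i$), and an edge $a_i\to\varepsilon$ iff $f_i=0$. Write $a\in\mathcal{X}$ for a vertex $a\ne\varepsilon$. A walk is a directed walk (vertices and edges may repeat); $|p|$ is the length of the walk $p$; for each vertex there is an empty walk of length $0$ to itself. $\mathcal{X}$ is strongly connected if for all $a,b\in\mathcal{X}$ there is a walk from $a$ to $b$. The loop number of $a\in\mathcal{X}$ is the minimum of all $t\ge 1$ such that $t=|p|-|q|$ for closed walks $p,q:a\to a$; it is $0$ if there is no closed walk of positive length at $a$. On a strongly connected $\mathcal{X}$ this number is the same for all vertices and is called the loop number of $\mathcal{X}$. Loop equivalence: $a\approx b$ iff there is a walk $p:a\to b$ with $|p|$ divisible by $t$, where $t$ is the loop number; this is an equivalence relation on the vertices $a_1,\dots,a_n$ with exactly $t$ classes. *)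

theory Defs
  imports "HOL-Library.Z2" "HOL-Library.FuncSet" "Graph_Theory.Arc_Walk"
begin

text \<open>
  The field with two elements is the type \<^typ>\<open>bit\<close>. Since the coordinates are enumerated
  and the dimension is a parameter, vectors are functions on \<open>{1..n}\<close>, made canonical by
  the value \<^const>\<open>undefined\<close> outside \<open>{1..n}\<close>.
\<close>

definition F2_space :: "nat \<Rightarrow> (nat \<Rightarrow> bit) set" where
  "F2_space n = {1..n} \<rightarrow>\<^sub>E UNIV"

text \<open>
  \<open>\<epsilon> j i\<close> is the exponent of the \<open>j\<close>-th variable in the \<open>i\<close>-th coordinate
  function. By the last condition \<open>f\<close> determines \<open>\<alpha>\<close> and \<open>\<epsilon>\<close> on the index range.
\<close>

definition boolean_monomial_system ::
  "nat \<Rightarrow> ((nat \<Rightarrow> bit) \<Rightarrow> nat \<Rightarrow> bit) \<Rightarrow> (nat \<Rightarrow> bit) \<Rightarrow> (nat \<Rightarrow> nat \<Rightarrow> nat) \<Rightarrow> bool" where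
  "boolean_monomial_system n f \<alpha> \<epsilon> \<longleftrightarrow>
     f \<in> F2_space n \<rightarrow> F2_space n \<and>
     (\<forall>x\<in>F2_space n. \<forall>i\<in>{1..n}. f x i = \<alpha> i * (\<Prod>j\<in>{1..n}. x j ^ \<epsilon> j i)) \<and>
     (\<forall>i\<in>{1..n}. \<forall>j\<in>{1..n}. \<epsilon> j i \<in> {0, 1}) \<and>
     (\<forall>i\<in>{1..n}. \<alpha> i = 0 \<longrightarrow> (\<forall>j\<in>{1..n}. \<epsilon> j i = 0))"

datatype vertex = Vert nat | Eps

type_synonym dgraph = "(vertex, vertex \<times> vertex) pre_digraph"

definition dependency_graph ::
  "nat \<Rightarrow> ((nat \<Rightarrow> bit) \<Rightarrow> nat \<Rightarrow> bit) \<Rightarrow> (nat \<Rightarrow> bit) \<Rightarrow> (nat \<Rightarrow> nat \<Rightarrow> nat) \<Rightarrow> dgraph" where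
  "dependency_graph n f \<alpha> \<epsilon> =
     \<lparr> verts = insert Eps (Vert ` {1..n}),
       arcs = {(Vert i, Vert j) | i j. i \<in> {1..n} \<and> j \<in> {1..n} \<and> \<alpha> i = 1 \<and> \<epsilon> j i = 1} \<union>
              {(Vert i, Eps) | i. i \<in> {1..n} \<and> (\<forall>x\<in>F2_space n. f x i = 0)},
       tail = fst, head = snd \<rparr>"

definition proper_verts :: "dgraph \<Rightarrow> vertex set" where
  "proper_verts G = verts G - {Eps}"

text \<open>
  Connectedness is only required between vertices other than \<^const>\<open>Eps\<close>, which has no
  outgoing arcs; hence this is not the library's strong connectedness of the whole digraph.
\<close>

definition dep_strongly_connected :: "dgraph \<Rightarrow> bool" where
  "dep_strongly_connected G \<longleftrightarrow>
     (\<forall>a\<in>proper_verts G. \<forall>b\<in>proper_verts G. \<exists>p. pre_digraph.awalk G a p b)"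

definition vertex_loop_number :: "dgraph \<Rightarrow> vertex \<Rightarrow> nat" where
  "vertex_loop_number G a =
     (if \<exists>p. pre_digraph.awalk G a p a \<and> length p > 0
      then LEAST t. t \<ge> 1 \<and>
             (\<exists>p q. pre_digraph.awalk G a p a \<and> pre_digraph.awalk G a q a \<and>
                    int t = int (length p) - int (length q))
      else 0)"

text \<open>The common value at all proper vertices; meaningful for strongly connected graphs.\<close>

definition loop_number :: "dgraph \<Rightarrow> nat" where
  "loop_number G = (THE t. \<forall>a\<in>proper_verts G. vertex_loop_number G a = t)"

definition loop_equivalence :: "dgraph \<Rightarrow> (vertex \<times> vertex) set" where
  "loop_equivalence G =
     {(a, b). a \<in> proper_verts G \<and> b \<in> proper_verts G \<and>
        (\<exists>p. pre_digraph.awalk G a p b \<and> loop_number G dvd length p)}"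

text \<open>
  In the following two definitions \<open>idx j\<close> is the last index of the \<open>j\<close>-th group,
  with \<open>idx 0 = 0\<close>.
\<close>

definition group_indices :: "(nat \<Rightarrow> nat) \<Rightarrow> nat \<Rightarrow> nat set" where
  "group_indices idx j = {idx (j - 1) + 1 .. idx j}"

definition group_prod :: "(nat \<Rightarrow> nat) \<Rightarrow> nat \<Rightarrow> (nat \<Rightarrow> bit) \<Rightarrow> bit" where
  "group_prod idx j x = (\<Prod>k\<in>group_indices idx j. x k)"

text \<open>Subscripts \<open>k \<ge> 1\<close> read modulo \<open>t\<close> in \<open>{1..t}\<close>.\<close>

definition cyclic_subscript :: "nat \<Rightarrow> nat \<Rightarrow> nat" where
  "cyclic_subscript t k = (k - 1) mod t + 1"

end

theory Submission
  imports Defs "HOL-Number_Theory.Cong"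
begin

text \<open>
  A coordinate of \<open>f\<^sup>k\<close> is the product of the variables that are reachable by a walk of
  length exactly \<open>k\<close>. Fixing a base vertex, the lengths of all walks to \<open>b\<close> agree modulo the
  loop number \<open>t\<close>, which gives a potential \<open>\<rho>\<close> such that every walk from \<open>a\<close> to \<open>b\<close> has length
  \<open>\<rho> b - \<rho> a\<close> modulo \<open>t\<close>. Conversely, the lengths of closed walks form a numerical semigroup
  containing all large multiples of \<open>t\<close>, so every large length with the right residue occurs.
  The potential increases by one from each loop equivalence class to the next.
\<close>

section \<open>Additive sets of natural numbers and their least positive difference\<close>

text \<open>Division with remainder among the differences of \<open>S\<close>: if \<open>t\<close>
  did not divide \<open>s\<close>, then \<open>s + s div t * q\<close> and
  \<open>s div t * (q + t)\<close> would be members of \<open>S\<close> whose difference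
  \<open>s mod t\<close> is positive and below \<open>t\<close>.\<close>

lemma dvd_of_least_difference:
  fixes S :: "nat set"
  assumes zero: "0 \<in> S" and add: "\<And>a b. a \<in> S \<Longrightarrow> b \<in> S \<Longrightarrow> a + b \<in> S"
    and t: "0 < t" "q \<in> S" "q + t \<in> S"
    and least: "\<And>r q. 0 < r \<Longrightarrow> q \<in> S \<Longrightarrow> q + r \<in> S \<Longrightarrow> t \<le> r"
    and s: "s \<in> S"
  shows "t dvd s"
proof (rule ccontr)
  assume "\<not> t dvd s"
  then have r: "0 < s mod t" by (simp add: dvd_eq_mod_eq_0)
  have mult: "u * a \<in> S" if "a \<in> S" for u a
    by (induction u) (auto simp: zero add that)
  have "s div t * (q + t) + s mod t = s + s div t * q"
    by (simp add: algebra_simps)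
  then have "t \<le> s mod t"
    using least[OF r mult[OF t(3), of "s div t"]] add[OF s mult[OF t(2), of "s div t"]] by simp
  then show False
    using mod_less_divisor[OF t(1), of s] by simp
qed

text \<open>Two members \<open>p = t * v\<close> and \<open>p + t\<close> suffice. Writing
  \<open>u = c * v + r\<close> with \<open>r < v\<close> gives
  \<open>t * u = (c - r) * p + r * (p + t)\<close>, which is a legitimate combination once
  \<open>r \<le> c\<close>; this holds for all \<open>u \<ge> v * v\<close>.\<close>

lemma eventually_multiple_mem:
  fixes S :: "nat set"
  assumes zero: "0 \<in> S" and add: "\<And>a b. a \<in> S \<Longrightarrow> b \<in> S \<Longrightarrow> a + b \<in> S"
    and t: "0 < t" "q \<in> S" "q + t \<in> S"
    and dvd: "\<And>s. s \<in> S \<Longrightarrow> t dvd s"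
  shows "\<exists>N. \<forall>u\<ge>N. t * u \<in> S"
proof -
  have mult: "u * a \<in> S" if "a \<in> S" for u a
    by (induction u) (auto simp: zero add that)
  \<comment> \<open>\<open>q\<close> itself may be 0. The sum \<open>q + (q + t)\<close> is
    positive, so \<open>v\<close> below is nonzero, and adding \<open>t\<close> to it gives twice
    \<open>q + t\<close>, again in \<open>S\<close>.\<close>
  define p where "p = q + (q + t)"
  have p: "p \<in> S" "p + t \<in> S" "0 < p"
    using t add[OF t(2,3)] add[OF t(3,3)] by (simp_all add: p_def add_ac)
  obtain v where v: "p = t * v" using dvd[OF p(1)] by (elim dvdE)
  have "t * u \<in> S" if "u \<ge> v * v" for u
  proof -
    have "0 < v" using p(3) v by (cases v) auto
    then have le: "u mod v \<le> u div v"
      using that by (meson div_greater_zero_iff less_eq_div_iff_mult_less_eq mod_less_divisor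
          order_less_imp_le order_trans)
    obtain d where d: "u div v = u mod v + d" using le by (auto simp: le_iff_add)
    have "t * u = t * (u div v * v + u mod v)" by simp
    also have "\<dots> = d * p + u mod v * (p + t)"
      unfolding d v by (simp only: algebra_simps)
    finally show ?thesis
      using add mult p(1,2) by metis
  qed
  then show ?thesis by blast
qed

section \<open>Walk lengths modulo t between points of a finite, mutually connected set\<close>

lemma relpow_trans: "(a, b) \<in> R ^^ k \<Longrightarrow> (b, c) \<in> R ^^ l \<Longrightarrow> (a, c) \<in> R ^^ (k + l)"
  by (auto simp: relpow_add)

text \<open>Finiteness of \<open>V\<close> makes one bound \<open>N\<close> valid for all pairs at
  once; this uniformity is what later allows a single exponent for all coordinates.\<close>

lemma strongly_connected_potential:
  fixes R :: "('a \<times> 'a) set" and t :: nat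
  assumes fin: "finite V"
    and conn: "\<And>a b. a \<in> V \<Longrightarrow> b \<in> V \<Longrightarrow> \<exists>k. (a, b) \<in> R ^^ k"
    and pos: "0 < t"
    and ex: "\<And>a. a \<in> V \<Longrightarrow> \<exists>q. (a, a) \<in> R ^^ q \<and> (a, a) \<in> R ^^ (q + t)"
    and least: "\<And>a r q. a \<in> V \<Longrightarrow> 0 < r \<Longrightarrow> (a, a) \<in> R ^^ q \<Longrightarrow> (a, a) \<in> R ^^ (q + r) \<Longrightarrow> t \<le> r"
  shows "\<exists>(\<rho> :: 'a \<Rightarrow> nat) N. \<forall>a\<in>V. \<forall>b\<in>V. \<forall>k.
    ((a, b) \<in> R ^^ k \<longrightarrow> [\<rho> b = \<rho> a + k] (mod t)) \<and>
    (N \<le> k \<longrightarrow> [\<rho> b = \<rho> a + k] (mod t) \<longrightarrow> (a, b) \<in> R ^^ k)"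
proof (cases "V = {}")
  case False
  then obtain v0 where v0: "v0 \<in> V" by blast
  have closed: "t dvd k" if "a \<in> V" "(a, a) \<in> R ^^ k" for a k
  proof -
    obtain q where "(a, a) \<in> R ^^ q" "(a, a) \<in> R ^^ (q + t)" using ex \<open>a \<in> V\<close> by blast
    then show ?thesis
      using that pos by (intro dvd_of_least_difference[of "{k. (a, a) \<in> R ^^ k}" t q])
        (auto intro: relpow_trans least)
  qed
  have large: "\<exists>N. \<forall>u\<ge>N. (a, a) \<in> R ^^ (t * u)" if "a \<in> V" for a
  proof -
    obtain q where "(a, a) \<in> R ^^ q" "(a, a) \<in> R ^^ (q + t)" using ex \<open>a \<in> V\<close> by blast
    then show ?thesis
      using that pos eventually_multiple_mem[of "{k. (a, a) \<in> R ^^ k}" t q]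
      by (auto intro: relpow_trans closed)
  qed
  obtain \<rho> where \<rho>: "\<And>b. b \<in> V \<Longrightarrow> (v0, b) \<in> R ^^ \<rho> b"
    using conn[OF v0] by metis
  \<comment> \<open>The walks from \<open>v0\<close> to \<open>b\<close> directly and by way of
    \<open>a\<close> are closed up by the same return walk of length \<open>h\<close>. Both total
    lengths are multiples of \<open>t\<close>, and \<open>h\<close> cancels.\<close>
  have cong: "[\<rho> b = \<rho> a + k] (mod t)" if "a \<in> V" "b \<in> V" "(a, b) \<in> R ^^ k" for a b k
  proof -
    obtain h where h: "(b, v0) \<in> R ^^ h" using conn[OF \<open>b \<in> V\<close> v0] by blast
    have "t dvd \<rho> b + h" "t dvd \<rho> a + k + h"
      using closed[OF v0] relpow_trans \<rho> h that by metis+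
    then have "[\<rho> b + h = \<rho> a + k + h] (mod t)" by (simp add: cong_def dvd_eq_mod_eq_0)
    then show ?thesis by (simp only: cong_add_rcancel_nat)
  qed
  have "\<exists>N. \<forall>k\<ge>N. [\<rho> b = \<rho> a + k] (mod t) \<longrightarrow> (a, b) \<in> R ^^ k" if "a \<in> V" "b \<in> V" for a b
  proof -
    obtain d where d: "(a, b) \<in> R ^^ d" using conn[OF \<open>a \<in> V\<close> \<open>b \<in> V\<close>] by blast
    obtain N where N: "\<And>u. u \<ge> N \<Longrightarrow> (a, a) \<in> R ^^ (t * u)" using large \<open>a \<in> V\<close> by blast
    \<comment> \<open>The surplus of \<open>k\<close> over one fixed walk of length \<open>d\<close>
      is a multiple \<open>t * u\<close>. The bound on \<open>k\<close> forces
      \<open>N \<le> u\<close>, so the surplus can be spent on a closed walk at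
      \<open>a\<close>.\<close>
    have "(a, b) \<in> R ^^ k" if k: "d + t * N \<le> k" "[\<rho> b = \<rho> a + k] (mod t)" for k
    proof -
      have "[\<rho> a + d = \<rho> a + k] (mod t)"
        using cong[OF \<open>a \<in> V\<close> \<open>b \<in> V\<close> d] k(2) by (meson cong_sym cong_trans)
      then have "[k = d] (mod t)"
        by (simp add: cong_add_lcancel_nat cong_sym_eq)
      then have "t dvd k - d"
        using k(1) by (simp add: cong_altdef_nat)
      then obtain u where u: "k - d = t * u" by (elim dvdE)
      then have "N \<le> u" using k(1) pos
        by (metis add_le_imp_le_diff add.commute mult_le_cancel1)
      then show ?thesis
        using relpow_trans[OF N d] u k(1) by (metis add_leD1 le_add_diff_inverse2)
    qed
    then show ?thesis by blast
  qed
  then obtain N where N: "\<And>a b k. a \<in> V \<Longrightarrow> b \<in> V \<Longrightarrow> N a b \<le> k \<Longrightarrow>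
      [\<rho> b = \<rho> a + k] (mod t) \<Longrightarrow> (a, b) \<in> R ^^ k"
    by metis
  define M where "M = Max ((\<lambda>(a, b). N a b) ` (V \<times> V))"
  have "N a b \<le> M" if "a \<in> V" "b \<in> V" for a b
    unfolding M_def using fin that by (intro Max_ge) auto
  with N have "(a, b) \<in> R ^^ k"
    if "a \<in> V" "b \<in> V" "M \<le> k" "[\<rho> b = \<rho> a + k] (mod t)" for a b k
    using that by (meson order_trans)
  with cong show ?thesis by (intro exI ballI allI conjI impI)
qed auto

section \<open>Walks as powers of the arc relation, and the loop number\<close>

text \<open>Only lengths matter from here on, so arc lists give way to relation powers. Even an
  empty \<open>awalk\<close> must start in \<open>verts G\<close>, hence the assumption on
  \<open>a\<close>; that arcs stay inside \<open>verts G\<close> carries it to the next vertex in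
  the induction.\<close>

lemma ex_awalk_iff_relpow:
  assumes "tail G = fst" "head G = snd" "arcs G \<subseteq> verts G \<times> verts G" "a \<in> verts G"
  shows "(\<exists>p. pre_digraph.awalk G a p b \<and> length p = k) \<longleftrightarrow> (a, b) \<in> arcs G ^^ k"
  using assms(4)
proof (induction k arbitrary: a)
  case 0
  then show ?case by (auto simp: pre_digraph.awalk_def pre_digraph.cas.simps)
next
  case (Suc k)
  have "(\<exists>p. pre_digraph.awalk G a p b \<and> length p = Suc k) \<longleftrightarrow>
      (\<exists>c. (a, c) \<in> arcs G \<and> (\<exists>p. pre_digraph.awalk G c p b \<and> length p = k))"
  proof safe
    fix p assume "pre_digraph.awalk G a p b" "length p = Suc k"
    then obtain c p' where "p = (a, c) # p'" "(a, c) \<in> arcs G"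
      "set p' \<subseteq> arcs G" "pre_digraph.cas G c p' b" "length p' = k"
      by (cases p) (auto simp: pre_digraph.awalk_def pre_digraph.cas.simps assms(1,2))
    then show "\<exists>c. (a, c) \<in> arcs G \<and> (\<exists>p. pre_digraph.awalk G c p b \<and> length p = k)"
      using assms(3) by (auto simp: pre_digraph.awalk_def)
  next
    fix c p assume "(a, c) \<in> arcs G" "pre_digraph.awalk G c p b" "k = length p"
    then show "\<exists>p'. pre_digraph.awalk G a p' b \<and> length p' = Suc (length p)"
      using Suc.prems
      by (intro exI[of _ "(a, c) # p"])
        (auto simp: pre_digraph.awalk_def pre_digraph.cas.simps assms(1,2))
  qed
  also have "\<dots> \<longleftrightarrow> (\<exists>c. (a, c) \<in> arcs G \<and> (c, b) \<in> arcs G ^^ k)"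
    using Suc.IH assms(3) by blast
  also have "\<dots> \<longleftrightarrow> (a, b) \<in> arcs G ^^ Suc k"
    by (meson relpow_Suc_D2 relpow_Suc_I2)
  finally show ?case .
qed

text \<open>The two closed walks of the definition enter only through their lengths, and their
  difference is a natural number, so the lengths can be written \<open>q\<close> and
  \<open>q + t\<close> without integers.\<close>

lemma vertex_loop_number_relpow:
  assumes "tail G = fst" "head G = snd" "arcs G \<subseteq> verts G \<times> verts G" "a \<in> verts G"
  shows "vertex_loop_number G a =
    (if \<exists>k>0. (a, a) \<in> arcs G ^^ k
     then LEAST t. t \<ge> 1 \<and> (\<exists>q. (a, a) \<in> arcs G ^^ q \<and> (a, a) \<in> arcs G ^^ (q + t)) else 0)"
proof -
  note walk = ex_awalk_iff_relpow[OF assms, of a, symmetric]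
  have "(\<exists>p. pre_digraph.awalk G a p a \<and> length p > 0) \<longleftrightarrow> (\<exists>k>0. (a, a) \<in> arcs G ^^ k)"
    unfolding walk by blast
  moreover have "(\<exists>p q. pre_digraph.awalk G a p a \<and> pre_digraph.awalk G a q a \<and>
      int t = int (length p) - int (length q)) \<longleftrightarrow>
    (\<exists>q. (a, a) \<in> arcs G ^^ q \<and> (a, a) \<in> arcs G ^^ (q + t))" for t
  proof -
    have "int t = int i - int j \<longleftrightarrow> i = j + t" for i j by auto
    then show ?thesis unfolding walk by metis
  qed
  ultimately show ?thesis by (simp only: vertex_loop_number_def)
qed

lemma dep_strongly_connected_relpow:
  assumes G: "tail G = fst" "head G = snd" "arcs G \<subseteq> verts G \<times> verts G"
    and conn: "dep_strongly_connected G"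
    and ab: "a \<in> proper_verts G" "b \<in> proper_verts G"
  shows "\<exists>k. (a, b) \<in> arcs G ^^ k"
proof -
  obtain p where "pre_digraph.awalk G a p b"
    using conn ab unfolding dep_strongly_connected_def by blast
  moreover have "a \<in> verts G" using ab by (simp add: proper_verts_def)
  ultimately show ?thesis using ex_awalk_iff_relpow[OF G] by blast
qed

text \<open>Prefixing a walk from \<open>d\<close> to \<open>c\<close> and appending one from
  \<open>c\<close> to \<open>d\<close> carries a pair of closed walks at \<open>c\<close> to a pair
  at \<open>d\<close> with the same difference of lengths. So the value is common to all proper
  vertices, and the existence of \<open>a\<close> makes it unique.\<close>

lemma loop_number_eq:
  assumes G: "tail G = fst" "head G = snd" "arcs G \<subseteq> verts G \<times> verts G"
    and conn: "dep_strongly_connected G" and a: "a \<in> proper_verts G"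
  shows "loop_number G = vertex_loop_number G a"
proof -
  have verts: "c \<in> verts G" if "c \<in> proper_verts G" for c
    using that by (simp add: proper_verts_def)
  let ?D = "\<lambda>c t. \<exists>q. (c, c) \<in> arcs G ^^ q \<and> (c, c) \<in> arcs G ^^ (q + t)"
  have transfer: "?D d t" if cd: "c \<in> proper_verts G" "d \<in> proper_verts G" and t: "?D c t" for c d t
  proof -
    obtain q where q: "(c, c) \<in> arcs G ^^ q" "(c, c) \<in> arcs G ^^ (q + t)" using t by blast
    obtain r where r: "(d, c) \<in> arcs G ^^ r"
      using dep_strongly_connected_relpow[OF G conn cd(2,1)] ..
    obtain s where s: "(c, d) \<in> arcs G ^^ s"
      using dep_strongly_connected_relpow[OF G conn cd] ..
    note walks = relpow_trans[OF relpow_trans[OF r q(1)] s] relpow_trans[OF relpow_trans[OF r q(2)] s]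
    have "r + (q + t) + s = r + q + s + t" by simp
    with walks(2) have "(d, d) \<in> arcs G ^^ (r + q + s + t)" by (simp only:)
    with walks(1) show ?thesis by (intro exI conjI)
  qed
  \<comment> \<open>The test for the default value 0 is restated through differences,
    \<open>k\<close> being the difference to the empty walk, so that it transfers together with the
    minimum.\<close>
  have closed: "(\<exists>k>0. (c, c) \<in> arcs G ^^ k) \<longleftrightarrow> (\<exists>k>0. ?D c k)" for c
  proof safe
    fix k :: nat assume "0 < k" "(c, c) \<in> arcs G ^^ k"
    then show "\<exists>k>0. ?D c k" by (intro exI[of _ k] conjI exI[of _ 0]) auto
  next
    fix k q :: nat assume "0 < k" "(c, c) \<in> arcs G ^^ (q + k)"
    then show "\<exists>k>0. (c, c) \<in> arcs G ^^ k" by (intro exI[of _ "q + k"]) auto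
  qed
  have "vertex_loop_number G c = vertex_loop_number G a" if c: "c \<in> proper_verts G" for c
  proof -
    have D: "?D c t \<longleftrightarrow> ?D a t" for t
      by (rule iffI) (fact transfer[OF c a] transfer[OF a c])+
    have "(\<exists>k>0. (c, c) \<in> arcs G ^^ k) \<longleftrightarrow> (\<exists>k>0. (a, a) \<in> arcs G ^^ k)"
      by (simp only: closed D)
    then show ?thesis
      by (simp only: D vertex_loop_number_relpow[OF G verts[OF a]]
          vertex_loop_number_relpow[OF G verts[OF c]])
  qed
  then show ?thesis
    unfolding loop_number_def by (intro the_equality) (blast, metis a)
qed

text \<open>A positive loop number excludes the default value 0, so some closed walk has positive
  length. Compared with the empty walk it shows that the minimum is taken over a nonempty set and
  hence is attained.\<close>

lemma loop_number_least_difference: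
  assumes G: "tail G = fst" "head G = snd" "arcs G \<subseteq> verts G \<times> verts G"
    and conn: "dep_strongly_connected G" and a: "a \<in> proper_verts G"
    and pos: "loop_number G \<ge> 1"
  shows "\<exists>q. (a, a) \<in> arcs G ^^ q \<and> (a, a) \<in> arcs G ^^ (q + loop_number G)"
    and "0 < r \<Longrightarrow> (a, a) \<in> arcs G ^^ q \<Longrightarrow> (a, a) \<in> arcs G ^^ (q + r) \<Longrightarrow> loop_number G \<le> r"
proof -
  let ?P = "\<lambda>t. t \<ge> 1 \<and> (\<exists>q. (a, a) \<in> arcs G ^^ q \<and> (a, a) \<in> arcs G ^^ (q + t))"
  have "a \<in> verts G" using a by (simp add: proper_verts_def)
  note eq = loop_number_eq[OF G conn a] vertex_loop_number_relpow[OF G this]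
  obtain k where k: "k > 0" "(a, a) \<in> arcs G ^^ k"
    using pos unfolding eq by (auto split: if_splits)
  then have "\<exists>k>0. (a, a) \<in> arcs G ^^ k" by blast
  then have L: "loop_number G = (LEAST t. ?P t)" unfolding eq by (rule if_P)
  have "?P k" using k by (auto intro!: exI[of _ 0])
  then have "?P (loop_number G)" unfolding L by (rule LeastI)
  then show "\<exists>q. (a, a) \<in> arcs G ^^ q \<and> (a, a) \<in> arcs G ^^ (q + loop_number G)" by blast
  show "loop_number G \<le> r" if "0 < r" "(a, a) \<in> arcs G ^^ q" "(a, a) \<in> arcs G ^^ (q + r)"
    unfolding L using that by (intro Least_le) auto
qed

section \<open>Iterates of the system read off from walks in the dependency graph\<close>

lemma bit_prod_eq_1_iff:
  fixes g :: "'a \<Rightarrow> bit"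
  assumes "finite A"
  shows "prod g A = 1 \<longleftrightarrow> (\<forall>x\<in>A. g x = 1)"
  using assms by (induction A rule: finite_induct) auto

lemma dependency_graph_simps:
  "tail (dependency_graph n f \<alpha> \<epsilon>) = fst"
  "head (dependency_graph n f \<alpha> \<epsilon>) = snd"
  "proper_verts (dependency_graph n f \<alpha> \<epsilon>) = Vert ` {1..n}"
  "arcs (dependency_graph n f \<alpha> \<epsilon>) \<subseteq>
    verts (dependency_graph n f \<alpha> \<epsilon>) \<times> verts (dependency_graph n f \<alpha> \<epsilon>)"
  by (auto simp: dependency_graph_def proper_verts_def)

lemma Eps_no_arc: "(Eps, b) \<notin> arcs (dependency_graph n f \<alpha> \<epsilon>)"
  by (auto simp: dependency_graph_def)

lemma Vert_arc_iff:
  "(Vert i, Vert j) \<in> arcs (dependency_graph n f \<alpha> \<epsilon>) \<longleftrightarrow>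
    i \<in> {1..n} \<and> j \<in> {1..n} \<and> \<alpha> i = 1 \<and> \<epsilon> j i = 1"
  by (auto simp: dependency_graph_def)

text \<open>\<open>Eps\<close> has no outgoing arcs, so a walk ending in a \<open>Vert\<close> never
  visits it.\<close>

lemma dependency_graph_step:
  "(Vert i, Vert l) \<in> arcs (dependency_graph n f \<alpha> \<epsilon>) ^^ Suc k \<longleftrightarrow>
    (\<exists>j. (Vert i, Vert j) \<in> arcs (dependency_graph n f \<alpha> \<epsilon>) \<and>
         (Vert j, Vert l) \<in> arcs (dependency_graph n f \<alpha> \<epsilon>) ^^ k)"
    (is "_ \<in> ?R ^^ _ \<longleftrightarrow> ?rhs")
proof
  assume "(Vert i, Vert l) \<in> ?R ^^ Suc k"
  then obtain c where c: "(Vert i, c) \<in> ?R" "(c, Vert l) \<in> ?R ^^ k"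
    using relpow_Suc_D2 by metis
  have "c \<noteq> Eps"
  proof
    assume "c = Eps"
    with c(2) show False by (cases k) (auto dest!: relpow_Suc_D2 simp: Eps_no_arc simp del: relpow.simps(2))
  qed
  with c show ?rhs by (cases c) auto
qed (meson relpow_Suc_I2)

text \<open>A product of bits is 1 exactly when all factors are, so repeated variables need no
  counting. The induction peels off the first arc, which corresponds to the outermost application of
  \<open>f\<close>.\<close>

lemma boolean_monomial_system_iterate:
  assumes sys: "boolean_monomial_system n f \<alpha> \<epsilon>"
    and \<alpha>: "\<And>i. i \<in> {1..n} \<Longrightarrow> \<alpha> i = 1"
    and x: "x \<in> F2_space n" and i: "i \<in> {1..n}"
  shows "(f ^^ k) x i = 1 \<longleftrightarrow>
    (\<forall>j\<in>{1..n}. (Vert i, Vert j) \<in> arcs (dependency_graph n f \<alpha> \<epsilon>) ^^ k \<longrightarrow> x j = 1)"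
  using i
proof (induction k arbitrary: i)
  case (Suc k)
  let ?R = "arcs (dependency_graph n f \<alpha> \<epsilon>)"
  have "(f ^^ k) x \<in> F2_space n"
    using x sys by (induction k) (auto simp: boolean_monomial_system_def)
  then have "(f ^^ Suc k) x i = \<alpha> i * (\<Prod>j\<in>{1..n}. (f ^^ k) x j ^ \<epsilon> j i)"
    using sys Suc.prems by (simp add: boolean_monomial_system_def)
  then have "(f ^^ Suc k) x i = 1 \<longleftrightarrow> (\<forall>j\<in>{1..n}. (f ^^ k) x j ^ \<epsilon> j i = 1)"
    using \<alpha> Suc.prems by (simp add: bit_prod_eq_1_iff)
  \<comment> \<open>A factor with exponent 0 is 1 and imposes no condition, even on a zero
    coordinate; exponent 1 means an arc, since \<open>\<alpha> i\<close> is 1.\<close>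
  also have "\<dots> \<longleftrightarrow> (\<forall>j\<in>{1..n}. (Vert i, Vert j) \<in> ?R \<longrightarrow> (f ^^ k) x j = 1)"
  proof -
    have "\<epsilon> j i \<in> {0, 1}" if "j \<in> {1..n}" for j
      using sys Suc.prems that unfolding boolean_monomial_system_def by blast
    then show ?thesis
      using \<alpha> Suc.prems by (intro ball_cong) (fastforce simp: Vert_arc_iff)+
  qed
  also have "\<dots> \<longleftrightarrow> (\<forall>l\<in>{1..n}. (Vert i, Vert l) \<in> ?R ^^ Suc k \<longrightarrow> x l = 1)"
    using Suc.IH unfolding dependency_graph_step by (metis Vert_arc_iff)
  finally show ?case .
qed auto

section \<open>The potential along the enumerated classes, and the periodic iterates\<close>

lemma ex_group:
  assumes "idx 0 = 0" "k \<in> {1..idx t}"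
  shows "\<exists>l\<in>{1..t}. k \<in> group_indices idx l"
  using assms(2)
proof (induction t)
  case (Suc t)
  show ?case
  proof (cases "k \<le> idx t")
    case True
    with Suc show ?thesis by fastforce
  next
    case False
    with Suc.prems show ?thesis by (intro bexI[of _ "Suc t"]) (auto simp: group_indices_def)
  qed
qed (use assms(1) in auto)

theorem theorem4p10:
  fixes n t :: nat
    and f :: "(nat \<Rightarrow> bit) \<Rightarrow> nat \<Rightarrow> bit"
    and \<alpha> :: "nat \<Rightarrow> bit"
    and \<epsilon> :: "nat \<Rightarrow> nat \<Rightarrow> nat"
    and idx :: "nat \<Rightarrow> nat"
    and G :: dgraph
  assumes system: "boolean_monomial_system n f \<alpha> \<epsilon>"
    and graph: "G = dependency_graph n f \<alpha> \<epsilon>"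
    and connected: "dep_strongly_connected G"
    and loop: "loop_number G = t" "t \<ge> 1"
    and ends: "idx 0 = 0" "idx t = n"
    and classes: "\<And>j. j \<in> {1..t} \<Longrightarrow>
      Vert ` group_indices idx j \<in> proper_verts G // loop_equivalence G"
    and edges: "\<And>j. 1 \<le> j \<Longrightarrow> j < t \<Longrightarrow> (Vert (idx j), Vert (idx j + 1)) \<in> arcs G"
  shows "\<exists>m::nat. \<forall>j::nat. \<forall>x\<in>F2_space n. \<forall>l\<in>{1..t}. \<forall>k\<in>group_indices idx l.
    (f ^^ (m * t + j)) x k = group_prod idx (cyclic_subscript t (j + l)) x"
proof -
  have G: "tail G = fst" "head G = snd" "arcs G \<subseteq> verts G \<times> verts G"
    and V: "proper_verts G = Vert ` {1..n}"
    by (simp_all add: graph dependency_graph_simps)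
  have verts: "a \<in> verts G" if "a \<in> proper_verts G" for a
    using that by (simp add: proper_verts_def)
  note walk = ex_awalk_iff_relpow[OF G verts]
  have conn: "\<exists>k. (a, b) \<in> arcs G ^^ k" if "a \<in> proper_verts G" "b \<in> proper_verts G" for a b
    using dep_strongly_connected_relpow[OF G connected that] .
  have fin: "finite (proper_verts G)" by (simp add: V)
  have pos: "0 < t" using loop by simp
  have ex: "\<exists>q. (a, a) \<in> arcs G ^^ q \<and> (a, a) \<in> arcs G ^^ (q + t)"
    if "a \<in> proper_verts G" for a
    using loop_number_least_difference(1)[OF G connected that] loop by simp
  have least: "t \<le> r" if "a \<in> proper_verts G" "0 < r"
    "(a, a) \<in> arcs G ^^ q" "(a, a) \<in> arcs G ^^ (q + r)" for a r q
    using loop_number_least_difference(2)[OF G connected that(1) _ that(2-4)] loop by simp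
  have "\<exists>(\<rho> :: vertex \<Rightarrow> nat) N. \<forall>a\<in>proper_verts G. \<forall>b\<in>proper_verts G. \<forall>k.
      ((a, b) \<in> arcs G ^^ k \<longrightarrow> [\<rho> b = \<rho> a + k] (mod t)) \<and>
      (N \<le> k \<longrightarrow> [\<rho> b = \<rho> a + k] (mod t) \<longrightarrow> (a, b) \<in> arcs G ^^ k)"
    by (rule strongly_connected_potential[OF fin conn pos ex least])
  then obtain \<rho> :: "vertex \<Rightarrow> nat" and N where
    \<rho>: "\<And>a b k. a \<in> proper_verts G \<Longrightarrow> b \<in> proper_verts G \<Longrightarrow>
      (a, b) \<in> arcs G ^^ k \<Longrightarrow> [\<rho> b = \<rho> a + k] (mod t)" and
    N: "\<And>a b k. a \<in> proper_verts G \<Longrightarrow> b \<in> proper_verts G \<Longrightarrow> N \<le> k \<Longrightarrow>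
      [\<rho> b = \<rho> a + k] (mod t) \<Longrightarrow> (a, b) \<in> arcs G ^^ k"
    by metis

  \<comment> \<open>A closed walk of positive length leaves \<open>Vert i\<close> by an arc to a
    proper vertex, and such arcs exist only where the coefficient is 1.\<close>
  have \<alpha>: "\<alpha> i = 1" if "i \<in> {1..n}" for i
  proof -
    have i: "Vert i \<in> proper_verts G" using that V by auto
    obtain q where "(Vert i, Vert i) \<in> arcs G ^^ (q + t)" using ex[OF i] by blast
    moreover obtain k where "q + t = Suc k" using pos by (cases "q + t") auto
    ultimately have "(Vert i, Vert i) \<in> arcs G ^^ Suc k" by (simp only:)
    then show ?thesis
      unfolding graph dependency_graph_step by (auto simp: Vert_arc_iff)
  qed

  \<comment> \<open>The empty walk, whose length 0 is divisible by \<open>t\<close>, puts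
    \<open>c\<close> into its own class, so the group is nonempty. Walks from \<open>c\<close> of
    length divisible by \<open>t\<close> do not change the potential modulo
    \<open>t\<close>.\<close>
  have group: "group_indices idx l \<noteq> {} \<and> group_indices idx l \<subseteq> {1..n} \<and>
      (\<exists>r. \<forall>k\<in>group_indices idx l. [\<rho> (Vert k) = r] (mod t))" if l: "l \<in> {1..t}" for l
  proof -
    obtain c where c: "c \<in> proper_verts G" and
      img: "Vert ` group_indices idx l = loop_equivalence G `` {c}"
      using classes[OF l] by (elim quotientE)
    have "(c, c) \<in> loop_equivalence G"
      using c walk[of c c 0] by (auto simp: loop_equivalence_def)
    with img have "Vert ` group_indices idx l \<noteq> {}" by blast
    moreover have "k \<in> {1..n} \<and> [\<rho> (Vert k) = \<rho> c] (mod t)" if k: "k \<in> group_indices idx l" for k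
    proof -
      have "(c, Vert k) \<in> loop_equivalence G" using img k by blast
      then obtain p where p: "Vert k \<in> proper_verts G"
        "pre_digraph.awalk G c p (Vert k)" "t dvd length p"
        using loop by (auto simp: loop_equivalence_def)
      then have "(c, Vert k) \<in> arcs G ^^ length p" using walk c by blast
      then have "[\<rho> (Vert k) = \<rho> c + length p] (mod t)" using \<rho> c p by blast
      with p(3) have "[\<rho> (Vert k) = \<rho> c] (mod t)"
        by (metis add.right_neutral cong_0_iff cong_add_lcancel_nat cong_trans)
      with p(1) V show ?thesis by auto
    qed
    ultimately show ?thesis by blast
  qed
  have group_V: "Vert k \<in> proper_verts G" if "l \<in> {1..t}" "k \<in> group_indices idx l" for l k
    using group[OF that(1)] that(2) V by blast
  have same: "[\<rho> (Vert k) = \<rho> (Vert k')] (mod t)"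
    if l: "l \<in> {1..t}" and k: "k \<in> group_indices idx l" and k': "k' \<in> group_indices idx l" for l k k'
  proof -
    obtain r where r: "\<And>k. k \<in> group_indices idx l \<Longrightarrow> [\<rho> (Vert k) = r] (mod t)"
      using group[OF l] by blast
    show ?thesis by (rule cong_trans[OF r[OF k] cong_sym[OF r[OF k']]])
  qed
  \<comment> \<open>The groups are nonempty intervals and so contain their end points, which are the
    vertices joined by the given edges.\<close>
  have last: "idx l \<in> group_indices idx l" and first: "idx (l - 1) + 1 \<in> group_indices idx l"
    if "l \<in> {1..t}" for l
    using group[OF that] by (auto simp: group_indices_def)

  \<comment> \<open>The edge into the next group raises the potential by 1, and constancy on each
    class spreads this to all members. The base point is \<open>Vert 1\<close> because the first
    group starts at \<open>idx 0 + 1\<close>.\<close>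
  have pot: "[\<rho> (Vert k) = \<rho> (Vert 1) + (l - 1)] (mod t)"
    if "l \<in> {1..t}" "k \<in> group_indices idx l" for l k
    using that
  proof (induction l arbitrary: k)
    case (Suc l)
    show ?case
    proof (cases "l = 0")
      case True
      then show ?thesis using Suc.prems same[OF _ Suc.prems(2) first] ends by simp
    next
      case False
      then have l: "l \<in> {1..t}" using Suc.prems by auto
      have e: "(Vert (idx l), Vert (idx l + 1)) \<in> arcs G ^^ 1"
        using edges[of l] False Suc.prems by simp
      have "[\<rho> (Vert k) = \<rho> (Vert (idx l + 1))] (mod t)"
        using same[OF Suc.prems(1,2) first[OF Suc.prems(1)]] by simp
      moreover have "[\<rho> (Vert (idx l + 1)) = \<rho> (Vert (idx l)) + 1] (mod t)"
        using \<rho>[OF group_V[OF l last[OF l]] _ e] group_V[OF Suc.prems(1) first[OF Suc.prems(1)]]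
        by simp
      moreover have "[\<rho> (Vert (idx l)) + 1 = \<rho> (Vert 1) + (l - 1) + 1] (mod t)"
        using Suc.IH[OF l last[OF l]] cong_add_rcancel_nat by blast
      ultimately show ?thesis
        using False by (metis Suc_eq_plus1 Suc_pred' add.assoc cong_trans diff_Suc_1 gr0I)
    qed
  qed simp

  have reach: "(Vert i, Vert k) \<in> arcs G ^^ M \<longleftrightarrow>
      k \<in> group_indices idx (cyclic_subscript t (M + l))"
    if M: "N \<le> M" and l: "l \<in> {1..t}" and i: "i \<in> group_indices idx l" and k: "k \<in> {1..n}" for M l i k
  proof -
    let ?c = "cyclic_subscript t (M + l)"
    have c: "?c \<in> {1..t}"
      using pos by (simp add: cyclic_subscript_def Suc_leI)
    have ik: "Vert i \<in> proper_verts G" "Vert k \<in> proper_verts G" using group_V[OF l i] k V by auto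
    have "(Vert i, Vert k) \<in> arcs G ^^ M \<longleftrightarrow> [\<rho> (Vert k) = \<rho> (Vert i) + M] (mod t)"
      by (rule iffI[OF \<rho>[OF ik] N[OF ik M]])
    also have "\<dots> \<longleftrightarrow> [\<rho> (Vert k) = \<rho> (Vert 1) + (M + l - 1)] (mod t)"
    proof -
      have "[\<rho> (Vert i) + M = \<rho> (Vert 1) + (l - 1) + M] (mod t)"
        using pot[OF l i] cong_add_rcancel_nat by blast
      also have "\<rho> (Vert 1) + (l - 1) + M = \<rho> (Vert 1) + (M + l - 1)" using l by simp
      finally show ?thesis by (simp only: cong_def)
    qed
    also have "\<dots> \<longleftrightarrow> k \<in> group_indices idx ?c"
    proof -
      obtain l' where l': "l' \<in> {1..t}" "k \<in> group_indices idx l'"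
        using ex_group[of idx k t] ends k by blast
      \<comment> \<open>As \<open>l' - 1\<close> is below \<open>t\<close>, it is its own residue,
        so the potential tells the groups apart. The claim is needed both for the group found by
        covering and for \<open>?c\<close>.\<close>
      have iff: "[\<rho> (Vert k) = \<rho> (Vert 1) + (M + l - 1)] (mod t) \<longleftrightarrow> l' - 1 = (M + l - 1) mod t"
        if "l' \<in> {1..t}" "k \<in> group_indices idx l'" for l'
      proof -
        have "[\<rho> (Vert k) = \<rho> (Vert 1) + (M + l - 1)] (mod t) \<longleftrightarrow>
            [\<rho> (Vert 1) + (l' - 1) = \<rho> (Vert 1) + (M + l - 1)] (mod t)"
          using pot[OF that] by (simp only: cong_def)
        also have "\<dots> \<longleftrightarrow> [l' - 1 = M + l - 1] (mod t)"
          by (rule cong_add_lcancel_nat)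
        also have "\<dots> \<longleftrightarrow> (l' - 1) mod t = (M + l - 1) mod t"
          by (rule cong_def)
        also have "(l' - 1) mod t = l' - 1" using that(1) by (intro mod_less) auto
        finally show ?thesis .
      qed
      show ?thesis
      proof
        assume "[\<rho> (Vert k) = \<rho> (Vert 1) + (M + l - 1)] (mod t)"
        then have "l' - 1 = (M + l - 1) mod t" using iff[OF l'] by blast
        with l'(1) have "l' = ?c"
          unfolding cyclic_subscript_def atLeastAtMost_iff by linarith
        with l' show "k \<in> group_indices idx ?c" by simp
      next
        assume "k \<in> group_indices idx ?c"
        then show "[\<rho> (Vert k) = \<rho> (Vert 1) + (M + l - 1)] (mod t)"
          using iff[OF c] by (simp add: cyclic_subscript_def)
      qed
    qed
    finally show ?thesis .
  qed

  \<comment> \<open>The bound \<open>N\<close> itself serves as \<open>m\<close>: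
    \<open>t \<ge> 1\<close> gives \<open>N \<le> N * t\<close>, and the multiple of
    \<open>t\<close> disappears from the cyclic subscript.\<close>
  have "(f ^^ (N * t + j)) x k = group_prod idx (cyclic_subscript t (j + l)) x"
    if x: "x \<in> F2_space n" and l: "l \<in> {1..t}" and k: "k \<in> group_indices idx l" for j x l k
  proof -
    let ?M = "N * t + j"
    have "N * 1 \<le> N * t" using loop(2) by (intro mult_le_mono2)
    then have M: "N \<le> ?M" by linarith
    have "N * t + j + l - 1 = (j + l - 1) + N * t" using l by simp
    then have c: "cyclic_subscript t (?M + l) = cyclic_subscript t (j + l)"
      by (simp add: cyclic_subscript_def)
    have "cyclic_subscript t (j + l) \<in> {1..t}"
      using pos by (simp add: cyclic_subscript_def Suc_leI)
    then have sub: "group_indices idx (cyclic_subscript t (j + l)) \<subseteq> {1..n}" using group by blast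
    have "k \<in> {1..n}" using group[OF l] k by blast
    then have "(f ^^ ?M) x k = 1 \<longleftrightarrow>
        (\<forall>i\<in>{1..n}. (Vert k, Vert i) \<in> arcs G ^^ ?M \<longrightarrow> x i = 1)"
      unfolding graph using boolean_monomial_system_iterate[OF system \<alpha> x] by blast
    also have "\<dots> \<longleftrightarrow> (\<forall>i\<in>group_indices idx (cyclic_subscript t (j + l)). x i = 1)"
      using reach[OF M l k] sub unfolding c by blast
    also have "\<dots> \<longleftrightarrow> group_prod idx (cyclic_subscript t (j + l)) x = 1"
      by (simp add: group_prod_def group_indices_def bit_prod_eq_1_iff)
    finally show ?thesis by (metis bit_not_one_iff)
  qed
  then show ?thesis by blast
qed

end
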